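(* Let $A^{(1)}\in\mathbb{R}_+^{n\times m_1},\ldots,A^{(k)}\in\mathbb{R}_+^{n\times m_k}$ have all rows nonzero and be such that $\operatorname{span}(A^{(1)})\cap\ldots\cap\operatorname{span}(A^{(k)})$ contains a positive vector. Then the alternating method stabilizes in a finite number of steps: for every positive initial vector $y^{(0)}\in\mathbb{R}_+^n$, the sequence $y^{(l)}=P_k\cdots P_1\,y^{(l-1)}$, $l\geq 1$, satisfies $y^{(l)}=y^{(l-1)}$ for some $l\ge 1$.
   Context: $\mathbb{R}_+$ denotes the nonnegative reals, $\oplus=\max$ (componentwise on vectors). $\operatorname{span}(A)$ is the set of all max combinations $\bigoplus_j\lambda_jA_{\cdot j}$, $\lambda_j\geq0$, of the columns of $A$. A vector is positive if all its coordinates are positive. $P_s$ is the nonlinear projector onto $\operatorname{span}(A^{(s)})$: $P_s(y)=\max\{v\in\operatorname{span}(A^{(s)})\mid v\leq y\}$ (greatest element for the componentwise order). The alternating method for the system $A^{(1)}\otimes x^1=\ldots=A^{(k)}\otimes x^k$ starts from an arbitrary positive $y^{(0)}$ and iterates $y^{(l)}=P_k\cdots P_1y^{(l-1)}$ (first $P_1$ is applied, then $P_2$, and so on). *)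

theory Defs
  imports Complex_Main "Jordan_Normal_Form.Matrix"
begin

definition nonneg_mat :: "real mat \<Rightarrow> bool" where
  "nonneg_mat A \<longleftrightarrow> (\<forall>i<dim_row A. \<forall>j<dim_col A. 0 \<le> A $$ (i, j))"

definition positive_vec :: "real vec \<Rightarrow> bool" where
  "positive_vec v \<longleftrightarrow> (\<forall>i<dim_vec v. 0 < v $ i)"

text \<open>The element 0, the neutral element of the maximum on the nonnegative reals, only
  matters for a matrix without columns: there the empty max combination is the zero vector.\<close>

definition max_combination :: "real mat \<Rightarrow> (nat \<Rightarrow> real) \<Rightarrow> real vec" where
  "max_combination A c =
     vec (dim_row A) (\<lambda>i. Max (insert 0 {c j * A $$ (i, j) | j. j < dim_col A}))"

definition max_span :: "real mat \<Rightarrow> real vec set" where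
  "max_span A = {max_combination A c | c. \<forall>j<dim_col A. 0 \<le> c j}"

text \<open>The order on vectors is the componentwise one. For a nonnegative \<open>A\<close> and a
  nonnegative \<open>y\<close> of matching dimension the greatest element exists.\<close>

definition projector :: "real mat \<Rightarrow> real vec \<Rightarrow> real vec" where
  "projector A y = (GREATEST v. v \<in> max_span A \<and> v \<le> y)"

text \<open>One sweep applies the projector of \<open>A 1\<close> first and that of \<open>A k\<close> last.\<close>

definition sweep :: "(nat \<Rightarrow> real mat) \<Rightarrow> nat \<Rightarrow> real vec \<Rightarrow> real vec" where
  "sweep A k y = fold (\<lambda>s. projector (A s)) [1..<Suc k] y"

definition alternating_seq ::
  "(nat \<Rightarrow> real mat) \<Rightarrow> nat \<Rightarrow> real vec \<Rightarrow> nat \<Rightarrow> real vec" where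
  "alternating_seq A k y0 l = (sweep A k ^^ l) y0"

end

theory Submission
  imports Defs
begin

text \<open>Write \<open>v\<close> for a positive vector in all the spans. Every projector sends a vector \<open>y\<close>
  below itself, but not below any nonnegative multiple of \<open>v\<close> that lies under \<open>y\<close>, so the sequence is
  decreasing and bounded away from 0 and has a positive limit \<open>w\<close>. This alone does not
  give finite stabilization; that comes from the piecewise monomial form of a projector. As
  \[ P(y)_i = \max_j A_{ij} \min_t y_t / A_{tj}, \]
  with \<open>t\<close> running over the support of column \<open>j\<close>, a positive entry of \<open>P(y)\<close> is an
  entry of \<open>y\<close> times one of the finitely many weights
  \<open>A\<^sub>i\<^sub>j / A\<^sub>t\<^sub>j\<close> (\<open>projector_entry\<close>), and this property survives composition
  (\<open>finitely_weighted_descent_comp\<close>), hence holds for a whole sweep.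

  Now divide all entries by those of \<open>w\<close>. The normalized entries tend to 1, each is an entry of
  the preceding vector times one of finitely many normalized weights, and quotients of normalized
  entries tend to 1; so from some moment on the only weight in use is 1. From
  then on the normalized entries are taken from the finite set of those present at that moment,
  and since they tend to 1, they end up being 1
  (\<open>finitely_weighted_decreasing_seq_stabilizes\<close>). Thus the limit is attained.\<close>

section \<open>The projector\<close>

lemma max_combination_le_iff:
  assumes A: "A \<in> carrier_mat n m" and y: "y \<in> carrier_vec n"
    and y0: "\<And>i. i < n \<Longrightarrow> 0 \<le> y $ i"
  shows "max_combination A c \<le> y \<longleftrightarrow> (\<forall>i<n. \<forall>j<m. c j * A $$ (i, j) \<le> y $ i)"
  using assms by (auto simp: max_combination_def less_eq_vec_def)

lemma max_combination_mono:
  assumes "A \<in> carrier_mat n m"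
    and "\<And>i j. i < n \<Longrightarrow> j < m \<Longrightarrow> c j * A $$ (i, j) \<le> d j * A $$ (i, j)"
  shows "max_combination A c \<le> max_combination A d"
proof -
  have "Max (insert 0 {c j * A $$ (i, j) | j. j < m})
      \<le> Max (insert 0 {d j * A $$ (i, j) | j. j < m})" (is "_ \<le> Max ?D") if i: "i < n" for i
  proof (rule Max.boundedI)
    fix a assume "a \<in> insert 0 {c j * A $$ (i, j) | j. j < m}"
    then consider "a = 0" | j where "j < m" "a = c j * A $$ (i, j)" by blast
    then show "a \<le> Max ?D"
    proof cases
      case 1
      then show ?thesis by (auto intro: Max_ge)
    next
      case (2 j)
      then have "a \<le> d j * A $$ (i, j)" using assms(2)[OF i] by simp
      also have "\<dots> \<le> Max ?D" using 2 by (intro Max_ge) auto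
      finally show ?thesis .
    qed
  qed auto
  then show ?thesis using assms(1) by (simp add: max_combination_def less_eq_vec_def)
qed

text \<open>The coefficients of the projection are the residuals: the largest multiple of
  column \<open>j\<close> below \<open>y\<close> has the coefficient \<open>min\<^sub>t y\<^sub>t / A\<^sub>t\<^sub>j\<close> over the support of the
  column. A zero column contributes nothing and gets the coefficient 0.\<close>

definition residual_coeff :: "real mat \<Rightarrow> real vec \<Rightarrow> nat \<Rightarrow> real" where
  "residual_coeff A y j =
     (if \<exists>t<dim_row A. 0 < A $$ (t, j)
      then Min {y $ t / A $$ (t, j) | t. t < dim_row A \<and> 0 < A $$ (t, j)} else 0)"

lemma le_residual_coeff_iff:
  assumes "\<exists>t<dim_row A. 0 < A $$ (t, j)"
  shows "c \<le> residual_coeff A y j \<longleftrightarrow>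
    (\<forall>t<dim_row A. 0 < A $$ (t, j) \<longrightarrow> c * A $$ (t, j) \<le> y $ t)"
proof -
  have "c \<le> residual_coeff A y j \<longleftrightarrow>
      (\<forall>t<dim_row A. 0 < A $$ (t, j) \<longrightarrow> c \<le> y $ t / A $$ (t, j))"
    unfolding residual_coeff_def if_P[OF assms] using assms by (subst Min_ge_iff) auto
  then show ?thesis by (simp add: pos_le_divide_eq)
qed

lemma residual_coeff_attained:
  assumes "\<exists>t<dim_row A. 0 < A $$ (t, j)"
  obtains t where "t < dim_row A" "0 < A $$ (t, j)" "residual_coeff A y j = y $ t / A $$ (t, j)"
proof -
  have "Min {y $ t / A $$ (t, j) | t. t < dim_row A \<and> 0 < A $$ (t, j)}
      \<in> {y $ t / A $$ (t, j) | t. t < dim_row A \<and> 0 < A $$ (t, j)}"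
    using assms by (intro Min_in) auto
  then obtain t where "t < dim_row A" "0 < A $$ (t, j)" "residual_coeff A y j = y $ t / A $$ (t, j)"
    unfolding residual_coeff_def if_P[OF assms] by blast
  then show ?thesis by (rule that)
qed

context
  fixes A :: "real mat" and y :: "real vec" and n m :: nat
  assumes A: "A \<in> carrier_mat n m" "nonneg_mat A"
    and y: "y \<in> carrier_vec n" "\<And>i. i < n \<Longrightarrow> 0 \<le> y $ i"
begin

lemma residual_coeff_nonneg: "0 \<le> residual_coeff A y j"
proof (cases "\<exists>t<dim_row A. 0 < A $$ (t, j)")
  case True
  then show ?thesis using le_residual_coeff_iff[OF True, of 0 y] A y by auto
qed (auto simp: residual_coeff_def)

lemma residual_combination_greatest:
  "max_combination A (residual_coeff A y) \<in> max_span A"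
  "max_combination A (residual_coeff A y) \<le> y"
  "u \<in> max_span A \<Longrightarrow> u \<le> y \<Longrightarrow> u \<le> max_combination A (residual_coeff A y)"
proof -
  have zero_or_pos: "A $$ (i, j) = 0 \<or> 0 < A $$ (i, j)" if "i < n" "j < m" for i j
    using that A by (auto simp: nonneg_mat_def less_le)
  show "max_combination A (residual_coeff A y) \<in> max_span A"
    using residual_coeff_nonneg by (auto simp: max_span_def)
  have "residual_coeff A y j * A $$ (i, j) \<le> y $ i" if "i < n" "j < m" for i j
    using zero_or_pos[OF that] le_residual_coeff_iff[of A j "residual_coeff A y j" y] that A y
    by auto
  then show "max_combination A (residual_coeff A y) \<le> y"
    using max_combination_le_iff[OF A(1) y] by blast
  assume "u \<in> max_span A" and uy: "u \<le> y"
  then obtain d where u: "u = max_combination A d" by (auto simp: max_span_def)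
  have d: "d j * A $$ (i, j) \<le> y $ i" if "i < n" "j < m" for i j
    using uy that max_combination_le_iff[OF A(1) y] unfolding u by blast
  have "d j * A $$ (i, j) \<le> residual_coeff A y j * A $$ (i, j)" if "i < n" "j < m" for i j
    using zero_or_pos[OF that]
  proof
    assume pos: "0 < A $$ (i, j)"
    then have "d j \<le> residual_coeff A y j"
      using le_residual_coeff_iff[of A j "d j" y] that d A by auto
    then show ?thesis using pos by simp
  qed simp
  then show "u \<le> max_combination A (residual_coeff A y)"
    unfolding u using max_combination_mono[OF A(1), of d "residual_coeff A y"] by blast
qed

lemma projector_eq_residual_combination:
  "projector A y = max_combination A (residual_coeff A y)"
  unfolding projector_def
  by (rule Greatest_equality) (simp_all add: residual_combination_greatest)

lemma projector_le: "projector A y \<le> y"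
  and le_projector: "u \<in> max_span A \<Longrightarrow> u \<le> y \<Longrightarrow> u \<le> projector A y"
  unfolding projector_eq_residual_combination by (fact residual_combination_greatest)+

text \<open>A positive entry of the projection comes from a column attaining the maximum and, within
  it, from a row attaining the minimum in the residual. The column is nonzero because the entry is
  positive, so such a row exists. The resulting weight is a ratio of matrix entries, and of these
  there are only finitely many, whatever \<open>y\<close> is.\<close>

lemma projector_entry:
  assumes i: "i < n" and pos: "0 < projector A y $ i"
  obtains j t where "j < m" "t < n" "projector A y $ i = A $$ (i, j) / A $$ (t, j) * y $ t"
proof -
  let ?S = "insert 0 {residual_coeff A y j * A $$ (i, j) | j. j < m}"
  have "projector A y $ i = Max ?S"
    using i A by (auto simp: projector_eq_residual_combination max_combination_def)
  moreover have "Max ?S \<in> ?S" by (intro Max_in) auto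
  ultimately obtain j where j: "j < m" "projector A y $ i = residual_coeff A y j * A $$ (i, j)"
    using pos by auto
  then have "0 < A $$ (i, j)"
    using pos i A by (auto simp: nonneg_mat_def less_le)
  then have ex: "\<exists>t<dim_row A. 0 < A $$ (t, j)" using i A by auto
  from ex obtain t where "t < dim_row A" "residual_coeff A y j = y $ t / A $$ (t, j)"
    by (rule residual_coeff_attained)
  then show ?thesis using that[of j t] j A by auto
qed

end

lemma smult_max_span:
  assumes "0 \<le> c" "v \<in> max_span A"
  shows "c \<cdot>\<^sub>v v \<in> max_span A"
proof -
  obtain d where d: "\<forall>j<dim_col A. 0 \<le> d j" "v = max_combination A d"
    using assms(2) by (auto simp: max_span_def)
  have "c * Max (insert 0 {d j * A $$ (i, j) | j. j < dim_col A})
      = Max (insert 0 {c * d j * A $$ (i, j) | j. j < dim_col A})" for i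
  proof -
    have "c * Max (insert 0 {d j * A $$ (i, j) | j. j < dim_col A})
        = Max ((*) c ` insert 0 {d j * A $$ (i, j) | j. j < dim_col A})"
      using assms(1) by (intro mono_Max_commute) (auto simp: mono_def mult_left_mono)
    also have "(*) c ` insert 0 {d j * A $$ (i, j) | j. j < dim_col A}
        = insert 0 {c * d j * A $$ (i, j) | j. j < dim_col A}"
    proof -
      have "{g j | j. j < dim_col A} = g ` {..<dim_col A}" for g :: "nat \<Rightarrow> real" by auto
      then show ?thesis by (simp add: image_image mult.assoc)
    qed
    finally show ?thesis .
  qed
  then have "c \<cdot>\<^sub>v v = max_combination A (\<lambda>j. c * d j)"
    unfolding d(2) by (auto simp: max_combination_def)
  moreover have "\<forall>j<dim_col A. 0 \<le> c * d j" using assms(1) d(1) by simp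
  ultimately show ?thesis
    unfolding max_span_def by (intro CollectI exI[of _ "\<lambda>j. c * d j"] conjI)
qed

section \<open>Descent with finitely many weights\<close>

text \<open>The two features of a sweep that force stabilization, in a form closed under composition:
  descent that stops above the multiples of \<open>v\<close>, and entries copied from the argument up to a
  weight in \<open>G\<close>. The domain is the set of vectors above a positive multiple of \<open>v\<close>, as an entry
  that vanishes need not come from a weight.\<close>

definition finitely_weighted_descent ::
  "nat \<Rightarrow> real vec \<Rightarrow> real set \<Rightarrow> (real vec \<Rightarrow> real vec) \<Rightarrow> bool" where
  "finitely_weighted_descent n v G f \<longleftrightarrow> finite G \<and>
     (\<forall>c>0. \<forall>y \<in> carrier_vec n. c \<cdot>\<^sub>v v \<le> y \<longrightarrow>
        c \<cdot>\<^sub>v v \<le> f y \<and> f y \<le> y \<and> (\<forall>i<n. \<exists>g\<in>G. \<exists>t<n. f y $ i = g * y $ t))"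

lemma le_carrier_vec: "(x :: real vec) \<le> y \<Longrightarrow> y \<in> carrier_vec n \<Longrightarrow> x \<in> carrier_vec n"
  unfolding less_eq_vec_def carrier_vec_def by simp

lemma finitely_weighted_descentD:
  assumes "finitely_weighted_descent n v G f" "0 < c" "y \<in> carrier_vec n" "c \<cdot>\<^sub>v v \<le> y"
  shows "c \<cdot>\<^sub>v v \<le> f y" "f y \<le> y" "\<forall>i<n. \<exists>g\<in>G. \<exists>t<n. f y $ i = g * y $ t"
  using assms unfolding finitely_weighted_descent_def by blast+

lemma finitely_weighted_descent_id: "finitely_weighted_descent n v {1} (\<lambda>y. y)"
proof -
  have "\<exists>g\<in>{1}. \<exists>t<n. y $ i = g * y $ t" if "i < n" for i and y :: "real vec"
    using that by (intro bexI[of _ 1] exI[of _ i]) simp_all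
  then show ?thesis unfolding finitely_weighted_descent_def by simp
qed

lemma finitely_weighted_descent_comp:
  assumes "finitely_weighted_descent n v G f" "finitely_weighted_descent n v H h"
  shows "finitely_weighted_descent n v ((\<lambda>(a, b). a * b) ` (H \<times> G)) (\<lambda>y. h (f y))"
  unfolding finitely_weighted_descent_def
proof (intro conjI allI impI ballI)
  show "finite ((\<lambda>(a, b). a * b) ` (H \<times> G))"
    using assms by (simp add: finitely_weighted_descent_def)
  fix c :: real and y :: "real vec"
  assume c: "0 < c" and y: "y \<in> carrier_vec n" "c \<cdot>\<^sub>v v \<le> y"
  note f = finitely_weighted_descentD[OF assms(1) c y]
  have fc: "f y \<in> carrier_vec n" using f(2) y(1) by (rule le_carrier_vec)
  note h = finitely_weighted_descentD[OF assms(2) c fc f(1)]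
  show "c \<cdot>\<^sub>v v \<le> h (f y)" by (fact h(1))
  show "h (f y) \<le> y" using h(2) f(2) by (rule order_trans)
  fix i assume "i < n"
  then obtain a t where a: "a \<in> H" "t < n" "h (f y) $ i = a * f y $ t" using h(3) by blast
  then obtain b t' where b: "b \<in> G" "t' < n" "f y $ t = b * y $ t'" using f(3) by blast
  then have "h (f y) $ i = (a * b) * y $ t'" using a by simp
  moreover have "a * b \<in> (\<lambda>(a, b). a * b) ` (H \<times> G)" using a b by auto
  ultimately show "\<exists>g\<in>(\<lambda>(a, b). a * b) ` (H \<times> G). \<exists>t<n. h (f y) $ i = g * y $ t"
    using b(2) by (intro bexI[of _ "a * b"] exI[of _ t'] conjI)
qed

lemma projector_finitely_weighted_descent:
  assumes A: "A \<in> carrier_mat n m" "nonneg_mat A"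
    and v: "v \<in> max_span A" "positive_vec v"
  shows "\<exists>G. finitely_weighted_descent n v G (projector A)"
proof -
  let ?G = "(\<lambda>(i, j, t). A $$ (i, j) / A $$ (t, j)) ` ({..<n} \<times> {..<m} \<times> {..<n})"
  have dim_v: "dim_vec v = n" using v(1) A by (auto simp: max_span_def max_combination_def)
  have "c \<cdot>\<^sub>v v \<le> projector A y \<and> projector A y \<le> y \<and>
      (\<forall>i<n. \<exists>g\<in>?G. \<exists>t<n. projector A y $ i = g * y $ t)"
    if c: "0 < c" and y: "y \<in> carrier_vec n" "c \<cdot>\<^sub>v v \<le> y" for c y
  proof (intro conjI allI impI)
    have pos: "0 < u $ i" if "c \<cdot>\<^sub>v v \<le> u" "i < n" for u i
    proof -
      have "0 < c * v $ i" using c v(2) dim_v that(2) by (simp add: positive_vec_def)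
      also have "\<dots> \<le> u $ i" using that dim_v by (auto simp: less_eq_vec_def)
      finally show ?thesis .
    qed
    have y0: "\<And>i. i < n \<Longrightarrow> 0 \<le> y $ i" using pos[OF y(2)] by (simp add: less_imp_le)
    show low: "c \<cdot>\<^sub>v v \<le> projector A y"
      using le_projector[OF A y(1) y0 smult_max_span[of c, OF _ v(1)] y(2)] c by simp
    show "projector A y \<le> y" by (rule projector_le[OF A y(1) y0])
    fix i assume i: "i < n"
    obtain j t where "j < m" "t < n" "projector A y $ i = A $$ (i, j) / A $$ (t, j) * y $ t"
      by (rule projector_entry[OF A y(1) y0 i pos[OF low i]])
    moreover from this have "A $$ (i, j) / A $$ (t, j) \<in> ?G"
      using i by (intro image_eqI[of _ _ "(i, j, t)"]) auto
    ultimately show "\<exists>g\<in>?G. \<exists>t<n. projector A y $ i = g * y $ t"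
      by (intro bexI[of _ "A $$ (i, j) / A $$ (t, j)"] exI[of _ t] conjI)
  qed
  then have "finitely_weighted_descent n v ?G (projector A)"
    unfolding finitely_weighted_descent_def by (intro conjI[OF finite_imageI]) simp_all
  then show ?thesis by blast
qed

lemma sweep_finitely_weighted_descent:
  assumes "\<And>s. s \<in> {1..k} \<Longrightarrow> A s \<in> carrier_mat n (m s)"
    and "\<And>s. s \<in> {1..k} \<Longrightarrow> nonneg_mat (A s)"
    and "\<And>s. s \<in> {1..k} \<Longrightarrow> v \<in> max_span (A s)" and v: "positive_vec v"
  shows "\<exists>G. finitely_weighted_descent n v G (sweep A k)"
  using assms(1-3)
proof (induction k)
  case 0
  have "sweep A 0 = (\<lambda>y. y)" by (auto simp: sweep_def)
  then show ?case using finitely_weighted_descent_id by metis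
next
  case (Suc k)
  have "\<exists>G. finitely_weighted_descent n v G (sweep A k)"
    by (rule Suc.IH) (simp_all add: Suc.prems)
  then obtain G where G: "finitely_weighted_descent n v G (sweep A k)" by blast
  have "\<exists>H. finitely_weighted_descent n v H (projector (A (Suc k)))"
    by (rule projector_finitely_weighted_descent[where m = "m (Suc k)"]) (simp_all add: Suc.prems v)
  then obtain H where H: "finitely_weighted_descent n v H (projector (A (Suc k)))" by blast
  have "sweep A (Suc k) = (\<lambda>y. projector (A (Suc k)) (sweep A k y))"
    by (auto simp: sweep_def)
  then show ?case using finitely_weighted_descent_comp[OF G H] by auto
qed

section \<open>Finite stabilization\<close>

lemma tendsto_eventually_eq_limit_or_notin_finite:
  fixes f :: "'a \<Rightarrow> 'b :: t1_space"
  assumes "(f \<longlongrightarrow> a) F" "finite S"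
  shows "eventually (\<lambda>x. f x \<in> S \<longrightarrow> f x = a) F"
proof -
  have "open (- (S - {a}))" using assms(2) by (intro open_Compl finite_imp_closed) simp
  then have "eventually (\<lambda>x. f x \<in> - (S - {a})) F"
    by (rule topological_tendstoD[OF assms(1)]) simp
  then show ?thesis by eventually_elim auto
qed

text \<open>Products of the weights in \<open>G\<close> can be dense in the positive reals, so the values
  that the sequence could take need not be discrete. It is the limit that excludes all
  but finitely many of them: close to it, only weights compatible with the limit can occur, and
  after division by the limit these are equal to 1.\<close>

lemma finitely_weighted_decreasing_seq_stabilizes:
  fixes x :: "nat \<Rightarrow> 'i \<Rightarrow> real"
  assumes I: "finite I" and G: "finite G"
    and dec: "\<And>i l. i \<in> I \<Longrightarrow> x (Suc l) i \<le> x l i"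
    and low: "\<And>i l. i \<in> I \<Longrightarrow> b i \<le> x l i" and b: "\<And>i. i \<in> I \<Longrightarrow> 0 < b i"
    and weighted: "\<And>i l. i \<in> I \<Longrightarrow> \<exists>g\<in>G. \<exists>t\<in>I. x (Suc l) i = g * x l t"
  shows "\<exists>l. \<forall>i\<in>I. x (Suc l) i = x l i"
proof -
  have "\<exists>w>0. (\<lambda>l. x l i) \<longlonglongrightarrow> w" if i: "i \<in> I" for i
  proof -
    have "decseq (\<lambda>l. x l i)" using dec[OF i] by (simp add: decseq_Suc_iff)
    then obtain w where w: "(\<lambda>l. x l i) \<longlonglongrightarrow> w"
      using decseq_convergent[of "\<lambda>l. x l i" "b i"] low[OF i] by metis
    have "b i \<le> w" using w low[OF i] by (intro LIMSEQ_le_const[OF w]) auto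
    then show ?thesis using w b[OF i] by (intro exI[of _ w]) auto
  qed
  then obtain w where w: "\<And>i. i \<in> I \<Longrightarrow> 0 < w i" "\<And>i. i \<in> I \<Longrightarrow> (\<lambda>l. x l i) \<longlonglongrightarrow> w i"
    by metis
  define r where "r l i = x l i / w i" for l i
  have r: "(\<lambda>l. r l i) \<longlonglongrightarrow> 1" if "i \<in> I" for i
    using tendsto_divide[OF w(2)[OF that] tendsto_const[of "w i"]] w(1)[OF that]
    by (simp add: r_def)
  have r_pos: "0 < r l i" if "i \<in> I" for l i
    using low[OF that, of l] b[OF that] w(1)[OF that] by (simp add: r_def)
  define R where "R = (\<lambda>(g, i, t). g * w t / w i) ` (G \<times> I \<times> I)"
  have "finite R" using I G by (simp add: R_def)
  \<comment> \<open>Eventually the quotients of normalized entries avoid all normalized weights except 1.\<close>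
  have "eventually (\<lambda>l. r (Suc l) i / r l t \<in> R \<longrightarrow> r (Suc l) i / r l t = 1) sequentially"
    if "i \<in> I" "t \<in> I" for i t
  proof (rule tendsto_eventually_eq_limit_or_notin_finite[OF _ \<open>finite R\<close>])
    show "(\<lambda>l. r (Suc l) i / r l t) \<longlonglongrightarrow> 1"
      using tendsto_divide[OF LIMSEQ_Suc[OF r[OF that(1)]] r[OF that(2)]] by simp
  qed
  then have "eventually (\<lambda>l. \<forall>i\<in>I. \<forall>t\<in>I.
      r (Suc l) i / r l t \<in> R \<longrightarrow> r (Suc l) i / r l t = 1) sequentially"
    using I by (simp add: eventually_ball_finite_distrib)
  then obtain L where L: "\<And>l i t. l \<ge> L \<Longrightarrow> i \<in> I \<Longrightarrow> t \<in> I \<Longrightarrow>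
      r (Suc l) i / r l t \<in> R \<Longrightarrow> r (Suc l) i / r l t = 1"
    by (auto simp: eventually_sequentially)
  have copy: "\<exists>t\<in>I. r (Suc l) i = r l t" if l: "l \<ge> L" and i: "i \<in> I" for l i
  proof -
    obtain g t where g: "g \<in> G" "t \<in> I" "x (Suc l) i = g * x l t" using weighted[OF i] by blast
    have "r (Suc l) i / r l t = g * w t / w i"
      using g r_pos[OF g(2), of l] w(1)[OF i] w(1)[OF g(2)] by (auto simp: r_def field_simps)
    also have "\<dots> \<in> R" using g i unfolding R_def by (intro image_eqI[of _ _ "(g, i, t)"]) auto
    finally have "r (Suc l) i / r l t = 1" using L[OF l i g(2)] by blast
    then have "r (Suc l) i = r l t" by (metis divide_eq_1_iff)
    then show ?thesis using g(2) by blast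
  qed
  \<comment> \<open>Hence no new normalized value appears after the index \<open>L\<close>.\<close>
  have range: "r (L + d) i \<in> r L ` I" if "i \<in> I" for d i
    using that
  proof (induction d arbitrary: i)
    case (Suc d)
    then show ?case using copy[of "L + d" i] by auto
  qed auto
  have "eventually (\<lambda>l. \<forall>i\<in>I. r l i \<in> r L ` I \<longrightarrow> r l i = 1) sequentially"
    using I tendsto_eventually_eq_limit_or_notin_finite[OF r]
    by (simp add: eventually_ball_finite_distrib)
  then obtain M where M: "\<And>l i. l \<ge> M \<Longrightarrow> i \<in> I \<Longrightarrow> r l i \<in> r L ` I \<Longrightarrow> r l i = 1"
    by (auto simp: eventually_sequentially)
  have "x (L + d) i = w i" if "d \<ge> M" "i \<in> I" for d i
    using M[of "L + d" i] range[of i d] that w(1)[of i] by (auto simp: r_def)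
  from this[of M] this[of "Suc M"] show ?thesis by (intro exI[of _ "L + M"]) auto
qed

lemma finitely_weighted_descent_stabilizes:
  assumes f: "finitely_weighted_descent n v G f"
    and v: "v \<in> carrier_vec n" "positive_vec v"
    and y: "y \<in> carrier_vec n" "positive_vec y"
  shows "\<exists>l. (f ^^ Suc l) y = (f ^^ l) y"
proof -
  have y_pos: "0 < y $ i" and v_pos: "0 < v $ i" if "i < n" for i
    using that v y by (auto simp: positive_vec_def)
  \<comment> \<open>Inserting 1 keeps the set of ratios nonempty in dimension 0.\<close>
  define c where "c = Min (insert 1 ((\<lambda>i. y $ i / v $ i) ` {..<n}))"
  have c: "0 < c" unfolding c_def using y_pos v_pos by (subst Min_gr_iff) auto
  have "c \<le> y $ i / v $ i" if "i < n" for i unfolding c_def using that by (intro Min_le) auto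
  then have "c \<cdot>\<^sub>v v \<le> y"
    using y(1) v(1) v_pos by (auto simp: less_eq_vec_def pos_le_divide_eq)
  then have iter: "(f ^^ l) y \<in> carrier_vec n \<and> c \<cdot>\<^sub>v v \<le> (f ^^ l) y" for l
  proof (induction l)
    case (Suc l)
    then have "c \<cdot>\<^sub>v v \<le> f ((f ^^ l) y)" "f ((f ^^ l) y) \<le> (f ^^ l) y"
      using finitely_weighted_descentD[OF f c] by blast+
    then show ?case using Suc le_carrier_vec by auto
  qed (use y in auto)
  have step: "(f ^^ Suc l) y \<le> (f ^^ l) y"
      "\<forall>i<n. \<exists>g\<in>G. \<exists>t<n. (f ^^ Suc l) y $ i = g * (f ^^ l) y $ t" for l
    using finitely_weighted_descentD(2,3)[OF f c, of "(f ^^ l) y"] iter[of l]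
    unfolding funpow.simps comp_apply by blast+
  have "\<exists>l. \<forall>i\<in>{..<n}. (f ^^ Suc l) y $ i = (f ^^ l) y $ i"
  proof (rule finitely_weighted_decreasing_seq_stabilizes[where G = G and b = "\<lambda>i. c * v $ i"])
    show "finite G" using f by (simp add: finitely_weighted_descent_def)
    fix i l assume i: "i \<in> {..<n}"
    then show "(f ^^ Suc l) y $ i \<le> (f ^^ l) y $ i"
      using step(1)[of l] iter[of l] unfolding less_eq_vec_def by auto
    show "c * v $ i \<le> (f ^^ l) y $ i" using iter[of l] i v by (auto simp: less_eq_vec_def)
    show "0 < c * v $ i" using c v_pos i by simp
    show "\<exists>g\<in>G. \<exists>t\<in>{..<n}. (f ^^ Suc l) y $ i = g * (f ^^ l) y $ t"
      using step(2)[of l] i unfolding Bex_def lessThan_iff by blast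
  qed simp
  then obtain l where "\<forall>i<n. (f ^^ Suc l) y $ i = (f ^^ l) y $ i" by auto
  then have "(f ^^ Suc l) y = (f ^^ l) y"
    using iter[of l] iter[of "Suc l"] by (intro eq_vecI) (auto simp del: funpow.simps)
  then show ?thesis by blast
qed

theorem theorem4p7:
  fixes n k :: nat and m :: "nat \<Rightarrow> nat" and A :: "nat \<Rightarrow> real mat" and y0 :: "real vec"
  assumes "\<And>s. s \<in> {1..k} \<Longrightarrow> A s \<in> carrier_mat n (m s)"
    and "\<And>s. s \<in> {1..k} \<Longrightarrow> nonneg_mat (A s)"
    and "\<And>s i. s \<in> {1..k} \<Longrightarrow> i < n \<Longrightarrow> row (A s) i \<noteq> 0\<^sub>v (m s)"
    and "\<exists>v \<in> (\<Inter>s\<in>{1..k}. max_span (A s)). positive_vec v"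
    and "y0 \<in> carrier_vec n" and "positive_vec y0"
  shows "\<exists>l\<ge>1. alternating_seq A k y0 l = alternating_seq A k y0 (l - 1)"
proof (cases "k = 0")
  \<comment> \<open>Without any matrix, the vector \<open>v\<close> may have any dimension.\<close>
  case True
  then show ?thesis
    by (intro exI[of _ 1]) (simp add: alternating_seq_def sweep_def)
next
  case False
  obtain v where v: "\<And>s. s \<in> {1..k} \<Longrightarrow> v \<in> max_span (A s)" "positive_vec v"
    using assms(4) by blast
  have "v \<in> max_span (A 1)" "A 1 \<in> carrier_mat n (m 1)" using v(1) assms(1) False by auto
  then have "v \<in> carrier_vec n" by (auto simp: max_span_def max_combination_def)
  moreover obtain G where "finitely_weighted_descent n v G (sweep A k)"
    using sweep_finitely_weighted_descent[of k A n m v] assms(1,2) v by blast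
  ultimately obtain l where "(sweep A k ^^ Suc l) y0 = (sweep A k ^^ l) y0"
    using finitely_weighted_descent_stabilizes v(2) assms(5,6) by blast
  then show ?thesis
    by (intro exI[of _ "Suc l"]) (simp add: alternating_seq_def del: funpow.simps)
qed

end
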